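(* Let $\mathbf{A}$ be a $W\times n$ matrix and $\varepsilon>0$. Any one-pass streaming algorithm (receiving the rows of $\mathbf{A}$ one at a time) that returns a matrix $\mathbf{B}$ such that $\|\mathbf{A}^\top\mathbf{A}-\mathbf{B}^\top\mathbf{B}\|_F\le\varepsilon\|\mathbf{A}\|_F^2$ with probability at least $\frac89$ requires $\Omega\!\left(\frac{n}{\varepsilon^2}\right)$ bits of space.
   Context: One-pass streaming model: the rows of $\mathbf{A}$ arrive one at a time, each seen once, and the algorithm must produce its output after the stream ends; space is the number of bits of memory used.
   Formalization: The bound is stated for ε ≤ 1−δ and 1/ε² ≤ K·min(n,W), with any fixed K, δ > 0 and an Ω-constant depending on K and δ; without this it fails (B = 0 works for ε ≥ 1; storing A or AᵀA is cheaper for tiny ε with bounded entries). *)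

theory Defs
  imports
    "HOL-Probability.Probability_Measure"
    "Jordan_Normal_Form.Matrix"
begin

definition frob_norm :: "real mat \<Rightarrow> real" where
  "frob_norm A = sqrt (\<Sum>i<dim_row A. \<Sum>j<dim_col A. (A $$ (i, j))\<^sup>2)"

text \<open>
  \<open>E\<close> holds the numbers that may occur as matrix entries: \<open>E = UNIV\<close> gives all real matrices, a
  finite \<open>E\<close> gives bounded-precision entries. It is a parameter because over all of \<open>\<real>\<close> rescaling
  a single row already defeats every finite memory when \<open>\<epsilon> < 1\<close>, so that the real case alone says
  nothing about bit complexity.

  For bounded entries a lower bound \<open>\<Omega>(n / \<epsilon>\<^sup>2)\<close> presupposes, up to logarithmic factors,
  \<open>1 / \<epsilon>\<^sup>2 = O(min n W)\<close>: the exact covariance matrix has \<open>n\<^sup>2\<close> entries and the whole stream has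
  \<open>W n\<close> entries, so either can be stored. It also presupposes \<open>\<epsilon> < 1\<close>: for \<open>\<epsilon> \<ge> 1\<close> the zero
  matrix is always a valid answer.
\<close>

definition input_matrices :: "real set \<Rightarrow> nat \<Rightarrow> nat \<Rightarrow> real mat set" where
  "input_matrices E W n = {A \<in> carrier_mat W n. elements_mat A \<subseteq> E}"

text \<open>
  A randomized one-pass algorithm. The memory contents are bit strings. The random tape, drawn
  from the probability measure \<open>tape\<close>, and the index of the arriving row may be consulted freely
  and are not charged as memory; only the memory is carried from one row to the next.
  Algorithms that toss fresh coins and pay for remembering them are a special case: the step
  with index \<open>t\<close> then reads its own part of the tape. There is no bound on computation, and the
  algorithm may depend on the matrix dimensions and on the accuracy.
\<close>

record stream_alg =
  tape :: "(nat \<Rightarrow> bool) measure"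
  start :: "(nat \<Rightarrow> bool) \<Rightarrow> bool list"
  step :: "(nat \<Rightarrow> bool) \<Rightarrow> nat \<Rightarrow> real Matrix.vec \<Rightarrow> bool list \<Rightarrow> bool list"
  answer :: "(nat \<Rightarrow> bool) \<Rightarrow> bool list \<Rightarrow> real mat"

primrec memory :: "stream_alg \<Rightarrow> (nat \<Rightarrow> bool) \<Rightarrow> real mat \<Rightarrow> nat \<Rightarrow> bool list" where
  "memory alg \<omega> A 0 = start alg \<omega>"
| "memory alg \<omega> A (Suc t) = step alg \<omega> t (Matrix.row A t) (memory alg \<omega> A t)"

definition result :: "stream_alg \<Rightarrow> (nat \<Rightarrow> bool) \<Rightarrow> real mat \<Rightarrow> real mat" where
  "result alg \<omega> A = answer alg \<omega> (memory alg \<omega> A (dim_row A))"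

definition uses_space :: "stream_alg \<Rightarrow> real mat set \<Rightarrow> nat \<Rightarrow> bool" where
  "uses_space alg \<A> s \<longleftrightarrow>
     (\<forall>A\<in>\<A>. \<forall>\<omega>\<in>space (tape alg). \<forall>t\<le>dim_row A. length (memory alg \<omega> A t) \<le> s)"

text \<open>The number of rows of \<open>B\<close> is left to the algorithm.\<close>

definition covariance_approx :: "real \<Rightarrow> real mat \<Rightarrow> real mat \<Rightarrow> bool" where
  "covariance_approx \<epsilon> A B \<longleftrightarrow>
     dim_col B = dim_col A \<and>
     frob_norm (transpose_mat A * A - transpose_mat B * B) \<le> \<epsilon> * (frob_norm A)\<^sup>2"

text \<open>
  A non-measurable event has \<open>measure\<close> zero, so the probability bound below also forces the
  success event to be measurable.
\<close>

definition approximates_covariance :: "stream_alg \<Rightarrow> real mat set \<Rightarrow> real \<Rightarrow> real \<Rightarrow> bool" where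
  "approximates_covariance alg \<A> \<epsilon> p \<longleftrightarrow>
     prob_space (tape alg) \<and>
     (\<forall>A\<in>\<A>. measure (tape alg)
        {\<omega> \<in> space (tape alg). covariance_approx \<epsilon> A (result alg \<omega> A)} \<ge> p)"

end

(*
  Some seed succeeds on more than half of any finite family of inputs, so the number of memory
  states is at least half the size of the family divided by the number of its members that one
  answer can serve. By the Plotkin bound an answer serves few inputs if the covariance matrices
  are pairwise far apart compared to \<epsilon> times their common trace.

  The family consists of matrices with k nonzero rows, all of whose entries are signs. When \<epsilon> is
  bounded away from 0, k = 1 and the rows are nearly orthogonal sign vectors. Here the balls around
  the covariance matrices do intersect when \<epsilon> is close to 1, but only boundedly many (depending on
  \<delta>) share a point. When \<epsilon> is small, k is of order 1 / \<epsilon>^2, part of the columns is a fixed Hadamard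
  block with orthogonal rows, and the remaining k * q entries (q at least n / 2) form a code.
*)
theory Submission
  imports Defs
begin

section \<open>Sign vectors\<close>

text \<open>The squared distances over all ordered pairs of \<open>S\<close> sum to at most
  \<open>2 * card S\<close> times the sum of squared distances to any centre \<open>h\<close>, with
  equality at the centroid. Hence a ball of squared radius \<open>r\<close> with
  \<open>D > 2 * r\<close> holds at most \<open>D / (D - 2 * r)\<close> points.\<close>

lemma plotkin_bound:
  fixes g :: "'a \<Rightarrow> 'i \<Rightarrow> real" and h :: "'i \<Rightarrow> real"
  assumes "finite S" and "S \<noteq> {}"
    and near: "\<And>x. x \<in> S \<Longrightarrow> (\<Sum>i\<in>I. (g x i - h i)\<^sup>2) \<le> r"
    and far: "\<And>x y. x \<in> S \<Longrightarrow> y \<in> S \<Longrightarrow> x \<noteq> y \<Longrightarrow> D \<le> (\<Sum>i\<in>I. (g x i - g y i)\<^sup>2)"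
  shows "real (card S) * (D - 2 * r) \<le> D"
proof -
  let ?m = "real (card S)"
  have m: "?m \<ge> 1"
    using assms(1,2) by (simp add: Suc_le_eq card_gt_0_iff)
  have scalar: "(\<Sum>x\<in>S. \<Sum>y\<in>S. (g x i - g y i)\<^sup>2) \<le> 2 * ?m * (\<Sum>x\<in>S. (g x i - h i)\<^sup>2)" for i
  proof -
    define a where "a x = g x i - h i" for x
    have "(\<Sum>x\<in>S. \<Sum>y\<in>S. (g x i - g y i)\<^sup>2)
        = (\<Sum>x\<in>S. \<Sum>y\<in>S. (a x)\<^sup>2 + (a y)\<^sup>2 - 2 * (a x * a y))"
      by (simp add: a_def power2_eq_square algebra_simps)
    also have "\<dots> = 2 * ?m * (\<Sum>x\<in>S. (a x)\<^sup>2) - 2 * (\<Sum>x\<in>S. a x)\<^sup>2"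
      by (simp add: sum.distrib sum_subtractf power2_eq_square sum_product
          flip: sum_distrib_left)
    also have "\<dots> \<le> 2 * ?m * (\<Sum>x\<in>S. (a x)\<^sup>2)"
      by simp
    finally show ?thesis
      by (simp add: a_def)
  qed
  have "?m * ((?m - 1) * D) = (\<Sum>x\<in>S. \<Sum>y\<in>S - {x}. D)"
    using m assms(1) by (simp add: of_nat_diff)
  also have "\<dots> \<le> (\<Sum>x\<in>S. \<Sum>y\<in>S - {x}. \<Sum>i\<in>I. (g x i - g y i)\<^sup>2)"
    by (intro sum_mono far) auto
  also have "\<dots> \<le> (\<Sum>x\<in>S. \<Sum>y\<in>S. \<Sum>i\<in>I. (g x i - g y i)\<^sup>2)"
    by (intro sum_mono sum_mono2 assms sum_nonneg) auto
  also have "\<dots> = (\<Sum>x\<in>S. \<Sum>i\<in>I. \<Sum>y\<in>S. (g x i - g y i)\<^sup>2)"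
    by (intro sum.cong refl sum.swap)
  also have "\<dots> = (\<Sum>i\<in>I. \<Sum>x\<in>S. \<Sum>y\<in>S. (g x i - g y i)\<^sup>2)"
    by (rule sum.swap)
  also have "\<dots> \<le> (\<Sum>i\<in>I. 2 * ?m * (\<Sum>x\<in>S. (g x i - h i)\<^sup>2))"
    by (intro sum_mono scalar)
  also have "\<dots> = 2 * ?m * (\<Sum>x\<in>S. \<Sum>i\<in>I. (g x i - h i)\<^sup>2)"
    by (subst sum.swap) (simp add: sum_distrib_left)
  also have "\<dots> \<le> 2 * ?m * (\<Sum>x\<in>S. r)"
    by (intro mult_left_mono sum_mono near) auto
  also have "\<dots> = ?m * (2 * ?m * r)"
    by simp
  finally have "(?m - 1) * D \<le> 2 * ?m * r"
    using m mult_le_cancel_left_pos[of ?m] by auto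
  then show ?thesis
    by (simp add: algebra_simps)
qed

section \<open>Concentration for random signs and nearly orthogonal codes\<close>

lemma cosh_le_exp_square:
  fixes t :: real
  assumes "0 \<le> t" and "t \<le> 1"
  shows "exp t + exp (- t) \<le> 2 * exp (t\<^sup>2)"
proof -
  have "exp t \<le> 1 + t + t\<^sup>2"
    using assms by (rule exp_bound)
  moreover have "exp (- t) \<le> 1 - t + t\<^sup>2"
  proof -
    \<comment> \<open>Multiplying the right-hand side by \<open>1 + t\<close> gives
      \<open>1 + t ^ 3\<close>.\<close>
    have "1 / (1 + t) \<le> 1 - t + t\<^sup>2"
      using assms by (simp add: divide_simps power2_eq_square algebra_simps)
    moreover have "exp (- t) \<le> 1 / (1 + t)"
      using assms exp_ge_add_one_self[of t] by (simp add: exp_minus divide_simps)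
    ultimately show ?thesis by linarith
  qed
  moreover have "1 + t\<^sup>2 \<le> exp (t\<^sup>2)"
    by (rule exp_ge_add_one_self)
  ultimately show ?thesis by linarith
qed

text \<open>Chernoff bound: each vector is weighted by the exponential of its correlation with
  \<open>y\<close>, and over the whole cube these weights sum to a product over the
  coordinates.\<close>

lemma card_correlated_signs:
  fixes y :: "'i \<Rightarrow> real" and t :: real
  assumes "finite I" and y: "\<And>i. i \<in> I \<Longrightarrow> y i \<in> {-1, 1}" and t: "0 \<le> t" "t \<le> 1"
  shows "real (card {x \<in> I \<rightarrow>\<^sub>E {-1, 1}. t * card I \<le> (\<Sum>i\<in>I. x i * y i)})
    \<le> 2 ^ card I * exp (- (t\<^sup>2 * card I / 4))"
proof -
  let ?U = "I \<rightarrow>\<^sub>E {-1, 1::real}"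
  let ?H = "{x \<in> ?U. t * card I \<le> (\<Sum>i\<in>I. x i * y i)}"
  let ?m = "real (card I)"
  have finU: "finite ?U"
    using assms(1) by (intro finite_PiE) auto
  \<comment> \<open>With m = \<open>card I\<close>, the parameter \<lambda> = \<open>t / 2\<close>
    minimises the exponent \<lambda>^2 m - \<lambda> t m that \<open>cosh_le_exp_square\<close>
    yields.\<close>
  have "real (card ?H) * exp (t\<^sup>2 * ?m / 2) = (\<Sum>x\<in>?H. exp (t / 2 * (t * ?m)))"
    by (simp add: power2_eq_square)
  also have "\<dots> \<le> (\<Sum>x\<in>?H. exp (t / 2 * (\<Sum>i\<in>I. x i * y i)))"
    using t by (intro sum_mono) (auto intro!: mult_left_mono)
  also have "\<dots> \<le> (\<Sum>x\<in>?U. exp (t / 2 * (\<Sum>i\<in>I. x i * y i)))"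
    by (intro sum_mono2 finU) auto
  also have "\<dots> = (\<Sum>x\<in>?U. \<Prod>i\<in>I. exp (t / 2 * (x i * y i)))"
    using assms(1) by (simp add: sum_distrib_left exp_sum)
  also have "\<dots> = (\<Prod>i\<in>I. \<Sum>v\<in>{-1, 1}. exp (t / 2 * (v * y i)))"
    using assms(1) by (subst prod_sum_PiE) auto
  \<comment> \<open>Multiplication by the sign \<open>y i\<close> permutes the two values of
    \<open>v\<close>, so the factors do not depend on \<open>y\<close>.\<close>
  also have "\<dots> = (\<Prod>i\<in>I. exp (t / 2) + exp (- (t / 2)))"
    using y by (intro prod.cong refl) fastforce
  also have "\<dots> = (exp (t / 2) + exp (- (t / 2))) ^ card I"
    by simp
  also have "\<dots> \<le> (2 * exp ((t / 2)\<^sup>2)) ^ card I"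
    using t by (intro power_mono cosh_le_exp_square) auto
  also have "\<dots> = 2 ^ card I * exp (t\<^sup>2 * ?m / 4)"
    by (simp add: power_mult_distrib exp_of_nat_mult[symmetric] power_divide mult.commute)
  finally have "real (card ?H) * exp (t\<^sup>2 * ?m / 2) * exp (- (t\<^sup>2 * ?m / 2))
      \<le> 2 ^ card I * exp (t\<^sup>2 * ?m / 4) * exp (- (t\<^sup>2 * ?m / 2))"
    by (rule mult_right_mono) simp
  then show ?thesis
    by (simp add: mult.assoc mult.commute[of "t\<^sup>2"] flip: exp_add)
qed

text \<open>Gilbert-Varshamov argument: every sign vector is strongly correlated with plus or minus
  some word of a maximal code, so the sets counted in \<open>card_correlated_signs\<close> cover the
  cube. The absolute value is needed for one-row inputs, since x and -x have the same covariance
  matrix.\<close>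

lemma exists_sign_code:
  fixes t :: real
  assumes "finite I" and "I \<noteq> {}" and t: "0 < t" "t < 1"
  obtains C where "C \<subseteq> I \<rightarrow>\<^sub>E {-1, 1::real}"
    and "\<And>x y. x \<in> C \<Longrightarrow> y \<in> C \<Longrightarrow> x \<noteq> y \<Longrightarrow> \<bar>\<Sum>i\<in>I. x i * y i\<bar> \<le> t * card I"
    and "exp (t\<^sup>2 * card I / 4) \<le> 2 * real (card C)"
proof -
  let ?U = "I \<rightarrow>\<^sub>E {-1, 1::real}"
  let ?m = "real (card I)"
  define ip where "ip x y = (\<Sum>i\<in>I. x i * y i)" for x y :: "'a \<Rightarrow> real"
  define code where "code C \<longleftrightarrow> C \<subseteq> ?U \<and> (\<forall>x\<in>C. \<forall>y\<in>C. x \<noteq> y \<longrightarrow> \<bar>ip x y\<bar> \<le> t * ?m)" for C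
  have finU: "finite ?U"
    using assms(1) by (intro finite_PiE) auto
  have ip_self: "ip x x = ?m" if "x \<in> ?U" for x
  proof -
    have "x i * x i = 1" if "i \<in> I" for i
      using PiE_mem[OF \<open>x \<in> ?U\<close> that] by auto
    then show ?thesis by (simp add: ip_def)
  qed
  have m: "?m > 0"
    using assms by (simp add: card_gt_0_iff)
  have "finite {C. code C}"
    by (rule finite_subset[of _ "Pow ?U"]) (use finU in \<open>auto simp: code_def\<close>)
  moreover have "code {}"
    by (simp add: code_def)
  ultimately obtain C where C: "code C" and maximal: "\<And>C'. code C' \<Longrightarrow> C \<subseteq> C' \<Longrightarrow> C' = C"
    using finite_has_maximal[of "{C. code C}"] by auto
  have CU: "C \<subseteq> ?U" and finC: "finite C"
    using C finU finite_subset by (auto simp: code_def)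
  let ?H = "\<lambda>y. {x \<in> ?U. t * ?m \<le> (\<Sum>i\<in>I. x i * y i)}"
  have cover: "?U \<subseteq> (\<Union>y\<in>C. ?H y \<union> ?H (\<lambda>i. - y i))"
  proof
    fix x assume x: "x \<in> ?U"
    have "\<exists>y\<in>C. t * ?m < \<bar>ip x y\<bar>"
    proof (cases "x \<in> C")
      case True
      \<comment> \<open>A codeword covers itself, because its correlation with itself is the full
        length.\<close>
      have "t * ?m < ?m"
        using t m by simp
      then show ?thesis
        using True ip_self[OF x] by (intro bexI[of _ x]) auto
    next
      case False
      then have not_code: "\<not> code (insert x C)"
        using maximal[of "insert x C"] by auto
      show ?thesis
      proof (rule ccontr)
        assume "\<not> ?thesis"
        then have xy: "\<bar>ip x y\<bar> \<le> t * ?m" if "y \<in> C" for y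
          using that by (simp add: not_less)
        moreover have "\<bar>ip y x\<bar> \<le> t * ?m" if "y \<in> C" for y
          using xy[OF that] by (simp add: ip_def mult.commute)
        ultimately have "code (insert x C)"
          using C x by (auto simp: code_def)
        then show False
          using not_code by blast
      qed
    qed
    then show "x \<in> (\<Union>y\<in>C. ?H y \<union> ?H (\<lambda>i. - y i))"
      using x by (force simp: ip_def sum_negf abs_if split: if_splits)
  qed
  have "2 ^ card I = real (card ?U)"
    using assms(1) by (simp add: card_PiE)
  also have "\<dots> \<le> real (card (\<Union>y\<in>C. ?H y \<union> ?H (\<lambda>i. - y i)))"
    using cover finU finC by (intro of_nat_mono card_mono) (auto intro: finite_subset)
  also have "\<dots> \<le> real (\<Sum>y\<in>C. card (?H y \<union> ?H (\<lambda>i. - y i)))"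
    by (intro of_nat_mono card_UN_le finC)
  also have "\<dots> \<le> (\<Sum>y\<in>C. 2 * (2 ^ card I * exp (- (t\<^sup>2 * ?m / 4))))"
    unfolding of_nat_sum
  proof (intro sum_mono)
    fix y assume "y \<in> C"
    then have y: "y i \<in> {-1, 1}" if "i \<in> I" for i
      using CU that by (auto simp: PiE_iff)
    have "- y i \<in> {-1, 1}" if "i \<in> I" for i
      using y[OF that] by auto
    then have "real (card (?H (\<lambda>i. - y i))) \<le> 2 ^ card I * exp (- (t\<^sup>2 * ?m / 4))"
      using assms by (intro card_correlated_signs) auto
    moreover have "real (card (?H y)) \<le> 2 ^ card I * exp (- (t\<^sup>2 * ?m / 4))"
      using assms y by (intro card_correlated_signs) auto
    moreover have "real (card (?H y \<union> ?H (\<lambda>i. - y i))) \<le> real (card (?H y)) + real (card (?H (\<lambda>i. - y i)))"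
      using card_Un_le[of "?H y" "?H (\<lambda>i. - y i)"] by linarith
    ultimately show "real (card (?H y \<union> ?H (\<lambda>i. - y i))) \<le> 2 * (2 ^ card I * exp (- (t\<^sup>2 * ?m / 4)))"
      by linarith
  qed
  also have "\<dots> = 2 ^ card I * (2 * real (card C) * exp (- (t\<^sup>2 * ?m / 4)))"
    by simp
  finally have "1 \<le> 2 * real (card C) * exp (- (t\<^sup>2 * ?m / 4))"
    by simp
  then have "exp (t\<^sup>2 * ?m / 4) \<le> 2 * real (card C)"
    by (simp add: exp_minus field_simps)
  then show thesis
    using C by (intro that[of C]) (auto simp: code_def ip_def)
qed

text \<open>Sylvester's doubling: H is replaced by the block matrix with block rows (H, H) and (H,
  -H).\<close>

lemma exists_hadamard:
  obtains h :: "nat \<Rightarrow> nat \<Rightarrow> real"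
  where "\<And>r i. h r i \<in> {-1, 1}"
    and "\<And>r r'. r < 2 ^ b \<Longrightarrow> r' < 2 ^ b \<Longrightarrow>
      (\<Sum>i<2 ^ b. h r i * h r' i) = (if r = r' then 2 ^ b else 0)"
proof -
  have "\<exists>h :: nat \<Rightarrow> nat \<Rightarrow> real. (\<forall>r i. h r i \<in> {-1, 1}) \<and>
      (\<forall>r<2 ^ b. \<forall>r'<2 ^ b. (\<Sum>i<2 ^ b. h r i * h r' i) = (if r = r' then 2 ^ b else 0))"
  proof (induction b)
    case 0
    show ?case by (intro exI[of _ "\<lambda>_ _. 1"]) auto
  next
    case (Suc b)
    then obtain h :: "nat \<Rightarrow> nat \<Rightarrow> real" where h1: "\<And>r i. h r i \<in> {-1, 1}"
      and h2: "\<And>r r'. r < 2 ^ b \<Longrightarrow> r' < 2 ^ b \<Longrightarrow>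
        (\<Sum>i<2 ^ b. h r i * h r' i) = (if r = r' then 2 ^ b else 0)"
      by blast
    let ?P = "2 ^ b :: nat"
    define g where "g r i = h (r mod ?P) (i mod ?P) * (if ?P \<le> r \<and> ?P \<le> i then -1 else 1)" for r i
    have "g r i \<in> {-1, 1}" for r i
      using h1[of "r mod ?P" "i mod ?P"] by (auto simp: g_def)
    moreover have "(\<Sum>i<2 ^ Suc b. g r i * g r' i) = (if r = r' then 2 ^ Suc b else 0)"
      if r: "r < 2 ^ Suc b" "r' < 2 ^ Suc b" for r r'
    proof -
      \<comment> \<open>The second half of the inner product repeats the first up to the sign
        \<open>\<sigma>\<close>. The two cancel when exactly one of \<open>r\<close>,
        \<open>r'\<close> lies in the lower block row.\<close>
      define \<sigma> :: real where "\<sigma> = (if (?P \<le> r) = (?P \<le> r') then 1 else -1)"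
      let ?s = "\<Sum>i<?P. h (r mod ?P) i * h (r' mod ?P) i"
      have "{..<2 ^ Suc b} = {..<?P} \<union> {?P..<?P + ?P}"
        by auto
      then have "(\<Sum>i<2 ^ Suc b. g r i * g r' i)
          = (\<Sum>i<?P. g r i * g r' i) + (\<Sum>i=?P..<?P + ?P. g r i * g r' i)"
        by (simp add: sum.union_disjoint ivl_disj_int)
      also have "(\<Sum>i=?P..<?P + ?P. g r i * g r' i) = (\<Sum>i<?P. g r (i + ?P) * g r' (i + ?P))"
        using sum.shift_bounds_nat_ivl[of "\<lambda>i. g r i * g r' i" 0 ?P ?P]
        by (simp add: atLeast0LessThan)
      also have "\<dots> = \<sigma> * ?s"
        unfolding sum_distrib_left by (intro sum.cong refl) (auto simp: g_def \<sigma>_def)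
      also have "(\<Sum>i<?P. g r i * g r' i) = ?s"
        by (intro sum.cong refl) (auto simp: g_def)
      finally have eq: "(\<Sum>i<2 ^ Suc b. g r i * g r' i) = ?s + \<sigma> * ?s" .
      have s: "?s = (if r mod ?P = r' mod ?P then 2 ^ b else 0)"
        by (rule h2) auto
      have md: "x mod ?P = (if ?P \<le> x then x - ?P else x)" if "x < 2 ^ Suc b" for x
        using that by (auto simp: le_mod_geq)
      show ?thesis
        unfolding eq s unfolding md[OF r(1)] md[OF r(2)] \<sigma>_def by auto
    qed
    ultimately show ?case by blast
  qed
  then show thesis
    using that by blast
qed

text \<open>Expanding the square leaves inner products of rows of \<open>h\<close>, and the mixed
  ones vanish. For Hadamard rows this turns distances between codewords into distances between
  covariance entries.\<close>

lemma orthogonal_rows_energy: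
  fixes h :: "nat \<Rightarrow> nat \<Rightarrow> real"
  assumes "\<And>r r'. r < k \<Longrightarrow> r' < k \<Longrightarrow> (\<Sum>i<P. h r i * h r' i) = (if r = r' then c else 0)"
  shows "(\<Sum>i<P. (\<Sum>r<k. h r i * d r)\<^sup>2) = c * (\<Sum>r<k. (d r)\<^sup>2)"
proof -
  have "(\<Sum>i<P. (\<Sum>r<k. h r i * d r)\<^sup>2)
      = (\<Sum>i<P. \<Sum>r<k. \<Sum>r'<k. d r * d r' * (h r i * h r' i))"
    by (simp add: power2_eq_square sum_product algebra_simps)
  also have "\<dots> = (\<Sum>r<k. \<Sum>i<P. \<Sum>r'<k. d r * d r' * (h r i * h r' i))"
    by (rule sum.swap)
  also have "\<dots> = (\<Sum>r<k. \<Sum>r'<k. \<Sum>i<P. d r * d r' * (h r i * h r' i))"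
    by (intro sum.cong refl sum.swap)
  also have "\<dots> = (\<Sum>r<k. \<Sum>r'<k. d r * d r' * (if r = r' then c else 0))"
    by (intro sum.cong refl) (simp add: assms flip: sum_distrib_left)
  also have "\<dots> = (\<Sum>r<k. c * (d r)\<^sup>2)"
  proof (intro sum.cong refl)
    fix r assume "r \<in> {..<k}"
    have "(\<Sum>r'<k. d r * d r' * (if r = r' then c else 0)) = (\<Sum>r'<k. if r = r' then d r * d r' * c else 0)"
      by (intro sum.cong) auto
    then show "(\<Sum>r'<k. d r * d r' * (if r = r' then c else 0)) = c * (d r)\<^sup>2"
      using \<open>r \<in> {..<k}\<close> by (simp add: power2_eq_square)
  qed
  finally show ?thesis
    by (simp add: sum_distrib_left)
qed

section \<open>Covariance matrices\<close>

lemma frob_norm_nonneg: "0 \<le> frob_norm A"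
  by (simp add: frob_norm_def sum_nonneg)

lemma frob_norm_square:
  assumes "A \<in> carrier_mat m n"
  shows "(frob_norm A)\<^sup>2 = (\<Sum>i<m. \<Sum>j<n. (A $$ (i, j))\<^sup>2)"
  using assms by (auto simp: frob_norm_def sum_nonneg)

lemma frob_norm_diff_square:
  assumes "X \<in> carrier_mat m n" and "Y \<in> carrier_mat m n"
  shows "(frob_norm (X - Y))\<^sup>2 = (\<Sum>i<m. \<Sum>j<n. (X $$ (i, j) - Y $$ (i, j))\<^sup>2)"
proof -
  have "X - Y \<in> carrier_mat m n"
    using assms(2) by (rule minus_carrier_mat)
  then show ?thesis
    using assms by (simp add: frob_norm_square)
qed

text \<open>This is \<open>plotkin_bound\<close> for n by n matrices under the Frobenius norm, with
  the covariance matrices of the inputs as points and that of \<open>B\<close> as centre. The common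
  mass \<open>T\<close> gives all inputs the same radius \<open>\<epsilon> * T\<close>.\<close>

lemma covariance_approx_card_le:
  assumes "finite S" and "S \<noteq> {}" and carrier: "S \<subseteq> carrier_mat W n"
    and "0 \<le> \<epsilon>"
    and approx: "\<And>A. A \<in> S \<Longrightarrow> covariance_approx \<epsilon> A B"
    and mass: "\<And>A. A \<in> S \<Longrightarrow> (frob_norm A)\<^sup>2 = T"
    and far: "\<And>A A'. A \<in> S \<Longrightarrow> A' \<in> S \<Longrightarrow> A \<noteq> A' \<Longrightarrow>
      D \<le> (frob_norm (transpose_mat A * A - transpose_mat A' * A'))\<^sup>2"
  shows "real (card S) * (D - 2 * (\<epsilon> * T)\<^sup>2) \<le> D"
proof -
  let ?G = "\<lambda>A. transpose_mat A * A :: real mat"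
  let ?I = "{..<n} \<times> {..<n}"
  have G: "?G A \<in> carrier_mat n n" if "A \<in> S" for A
    using that carrier by auto
  \<comment> \<open>The row count of \<open>B\<close> is arbitrary; its column count is read off
    from any input that it approximates.\<close>
  have B: "?G B \<in> carrier_mat n n"
  proof -
    obtain A where "A \<in> S" using assms(2) by auto
    then have "dim_col B = n"
      using approx[of A] carrier by (auto simp: covariance_approx_def)
    then show ?thesis by (auto intro!: carrier_matI)
  qed
  have dist: "(frob_norm (X - Y))\<^sup>2 = (\<Sum>p\<in>?I. (X $$ p - Y $$ p)\<^sup>2)"
    if "X \<in> carrier_mat n n" "Y \<in> carrier_mat n n" for X Y :: "real mat"
    using that by (simp add: frob_norm_diff_square sum.cartesian_product case_prod_unfold)
  show ?thesis
  proof (rule plotkin_bound[where g = "\<lambda>A p. ?G A $$ p" and h = "\<lambda>p. ?G B $$ p" and I = ?I])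
    fix A assume A: "A \<in> S"
    have "frob_norm (?G A - ?G B) \<le> \<epsilon> * T"
      using approx[OF A] mass[OF A] by (simp add: covariance_approx_def)
    then show "(\<Sum>p\<in>?I. (?G A $$ p - ?G B $$ p)\<^sup>2) \<le> (\<epsilon> * T)\<^sup>2"
      using dist[OF G[OF A] B] power_mono frob_norm_nonneg by metis
  next
    fix A A' assume A: "A \<in> S" "A' \<in> S" "A \<noteq> A'"
    show "D \<le> (\<Sum>p\<in>?I. (?G A $$ p - ?G A' $$ p)\<^sup>2)"
      using far[OF A] dist[OF G[OF A(1)] G[OF A(2)]] by simp
  qed (use assms(1,2) in auto)
qed

section \<open>Inputs with signs in the top rows and zeros below\<close>

lemma mat_in_input_matrices:
  assumes "\<And>i j. i < W \<Longrightarrow> j < n \<Longrightarrow> f (i, j) \<in> E"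
  shows "mat W n f \<in> input_matrices E W n"
  using assms unfolding input_matrices_def elements_mat_def by auto

text \<open>Zero rows fill up the prescribed row count \<open>W\<close> without affecting mass or
  covariance.\<close>

definition top_rows :: "nat \<Rightarrow> nat \<Rightarrow> nat \<Rightarrow> (nat \<Rightarrow> nat \<Rightarrow> real) \<Rightarrow> real mat" where
  "top_rows W n k a = mat W n (\<lambda>(r, j). if r < k then a r j else 0)"

lemma top_rows_carrier [simp]: "top_rows W n k a \<in> carrier_mat W n"
  by (simp add: top_rows_def)

lemma sum_top_rows:
  fixes f :: "nat \<Rightarrow> real"
  assumes "k \<le> W"
  shows "(\<Sum>r<W. if r < k then f r else 0) = (\<Sum>r<k. f r)"
proof -
  have "{..<W} \<inter> {r. r < k} = {..<k}"
    using assms by auto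
  then show ?thesis
    by (simp add: sum.If_cases)
qed

lemma top_rows_input:
  assumes "{-1, 0, 1} \<subseteq> E" and "\<And>r j. r < k \<Longrightarrow> j < n \<Longrightarrow> a r j \<in> {-1, 1}"
  shows "top_rows W n k a \<in> input_matrices E W n"
  unfolding top_rows_def
proof (rule mat_in_input_matrices)
  fix r j assume "j < n"
  then have "r < k \<Longrightarrow> a r j \<in> E" "0 \<in> E"
    using assms(1) assms(2)[of r j] by auto
  then show "(case (r, j) of (r, j) \<Rightarrow> if r < k then a r j else 0) \<in> E"
    by simp
qed

lemma top_rows_mass:
  assumes "k \<le> W" and "\<And>r j. r < k \<Longrightarrow> j < n \<Longrightarrow> a r j \<in> {-1, 1}"
  shows "(frob_norm (top_rows W n k a))\<^sup>2 = real k * real n"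
proof -
  have sq: "(a r j)\<^sup>2 = 1" if "r < k" "j < n" for r j
    using assms(2)[OF that] by auto
  have "(frob_norm (top_rows W n k a))\<^sup>2 = (\<Sum>r<W. \<Sum>j<n. (top_rows W n k a $$ (r, j))\<^sup>2)"
    by (rule frob_norm_square) simp
  also have "\<dots> = (\<Sum>r<W. if r < k then real n else 0)"
    by (intro sum.cong refl) (auto simp: top_rows_def sq)
  finally show ?thesis
    using assms(1) by (simp add: sum_top_rows)
qed

lemma top_rows_covariance:
  assumes "k \<le> W" and "i < n" and "j < n"
  shows "(transpose_mat (top_rows W n k a) * top_rows W n k a) $$ (i, j) = (\<Sum>r<k. a r i * a r j)"
proof -
  have "(transpose_mat (top_rows W n k a) * top_rows W n k a) $$ (i, j)
      = (\<Sum>r<W. (if r < k then a r i else 0) * (if r < k then a r j else 0))"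
    using assms by (simp add: top_rows_def scalar_prod_def atLeast0LessThan)
  also have "\<dots> = (\<Sum>r<W. if r < k then a r i * a r j else 0)"
    by (intro sum.cong) auto
  finally show ?thesis
    using assms(1) by (simp add: sum_top_rows)
qed

lemma top_rows_distance:
  assumes "k \<le> W"
  shows "(frob_norm (transpose_mat (top_rows W n k a) * top_rows W n k a
        - transpose_mat (top_rows W n k a') * top_rows W n k a'))\<^sup>2
    = (\<Sum>i<n. \<Sum>j<n. ((\<Sum>r<k. a r i * a r j) - (\<Sum>r<k. a' r i * a' r j))\<^sup>2)"
proof -
  let ?G = "\<lambda>a. transpose_mat (top_rows W n k a) * top_rows W n k a"
  have carrier: "?G a \<in> carrier_mat n n" for a
    using top_rows_carrier by (metis mult_carrier_mat transpose_carrier_mat)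
  have "(frob_norm (?G a - ?G a'))\<^sup>2 = (\<Sum>i<n. \<Sum>j<n. (?G a $$ (i, j) - ?G a' $$ (i, j))\<^sup>2)"
    using carrier carrier by (rule frob_norm_diff_square)
  also have "\<dots> = (\<Sum>i<n. \<Sum>j<n. ((\<Sum>r<k. a r i * a r j) - (\<Sum>r<k. a' r i * a' r j))\<^sup>2)"
    using assms by (intro sum.cong refl) (simp add: top_rows_covariance)
  finally show ?thesis .
qed

section \<open>Counting memory states\<close>

text \<open>Averaging over seeds: the expected number of inputs in \<open>C\<close> answered
  correctly is at least 8/9 of \<open>card C\<close>, so not every seed can serve only half of
  them.\<close>

lemma exists_good_seed:
  assumes approx: "approximates_covariance alg \<A> \<epsilon> (8/9)"
    and "C \<subseteq> \<A>" "finite C" "C \<noteq> {}"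
  obtains \<omega> where "\<omega> \<in> space (tape alg)"
    and "card C < 2 * card {A \<in> C. covariance_approx \<epsilon> A (result alg \<omega> A)}"
proof -
  interpret prob_space "tape alg"
    using approx by (simp add: approximates_covariance_def)
  let ?ok = "\<lambda>A. {\<omega> \<in> space (tape alg). covariance_approx \<epsilon> A (result alg \<omega> A)}"
  let ?good = "\<lambda>\<omega>. {A \<in> C. covariance_approx \<epsilon> A (result alg \<omega> A)}"
  have p: "8/9 \<le> prob (?ok A)" if "A \<in> C" for A
    using approx that assms(2) by (auto simp: approximates_covariance_def)
  \<comment> \<open>A non-measurable event would have measure zero, against the bound 8/9.\<close>
  have ok: "?ok A \<in> events" if "A \<in> C" for A
    using p[OF that] measure_notin_sets[of "?ok A" "tape alg"] by force
  have int: "integrable (tape alg) (indicator (?ok A) :: _ \<Rightarrow> real)" if "A \<in> C" for A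
    using ok[OF that] by (intro integrable_real_indicator) (auto simp: emeasure_eq_measure)
  have count: "real (card (?good \<omega>)) = (\<Sum>A\<in>C. indicator (?ok A) \<omega>)"
    if "\<omega> \<in> space (tape alg)" for \<omega>
    using that assms(3) by (simp add: indicator_def sum.If_cases Int_def)
  have "\<exists>\<omega>\<in>space (tape alg). card C < 2 * card (?good \<omega>)"
  proof (rule ccontr)
    assume "\<not> ?thesis"
    then have small: "(\<Sum>A\<in>C. indicator (?ok A) \<omega>) \<le> real (card C) / 2"
      if "\<omega> \<in> space (tape alg)" for \<omega>
      using that by (force simp flip: count)
    have "8/9 * real (card C) = (\<Sum>A\<in>C. 8/9)"
      by simp
    also have "\<dots> \<le> (\<Sum>A\<in>C. prob (?ok A))"
      by (intro sum_mono p)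
    also have "\<dots> = (\<integral>\<omega>. (\<Sum>A\<in>C. indicator (?ok A) \<omega>) \<partial>tape alg)"
      using ok int by (subst Bochner_Integration.integral_sum) (auto simp: Int_absorb2 sets.sets_into_space)
    also have "\<dots> \<le> (\<integral>\<omega>. real (card C) / 2 \<partial>tape alg)"
      using small by (intro integral_mono Bochner_Integration.integrable_sum int) auto
    also have "\<dots> = real (card C) / 2"
      by (simp add: prob_space)
    finally show False
      using assms(3,4) by (simp add: card_gt_0_iff)
  qed
  then show thesis
    using that by blast
qed

text \<open>For a fixed seed the answer is a function of the final memory word. The inputs served
  correctly thus split into fibres over these words, each of size at most \<open>L\<close>.\<close>

lemma memory_lower_bound:
  fixes L :: real
  assumes "approximates_covariance alg (input_matrices E W n) \<epsilon> (8/9)"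
    and space: "uses_space alg (input_matrices E W n) s"
    and C: "C \<subseteq> input_matrices E W n" and "finite C" "C \<noteq> {}"
    and fibre: "\<And>S B. S \<subseteq> C \<Longrightarrow> S \<noteq> {} \<Longrightarrow> (\<And>A. A \<in> S \<Longrightarrow> covariance_approx \<epsilon> A B) \<Longrightarrow> real (card S) \<le> L"
    and "0 \<le> L"
  shows "real (card C) < 2 * L * (2 ^ Suc s - 1)"
proof -
  obtain \<omega> where \<omega>: "\<omega> \<in> space (tape alg)"
    and half: "card C < 2 * card {A \<in> C. covariance_approx \<epsilon> A (result alg \<omega> A)}"
    using exists_good_seed[OF assms(1) C assms(4,5)] by blast
  let ?good = "{A \<in> C. covariance_approx \<epsilon> A (result alg \<omega> A)}"
  let ?F = "\<lambda>w. {A \<in> C. covariance_approx \<epsilon> A (answer alg \<omega> w)}"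
  let ?M = "{w :: bool list. length w \<le> s}"
  have M_lists: "?M = {w. set w \<subseteq> UNIV \<and> length w \<le> s}"
    by simp
  have finM: "finite ?M"
    unfolding M_lists by (rule finite_lists_length_le) simp
  have "card ?M = (\<Sum>i\<le>s. 2 ^ i)"
    unfolding M_lists by (subst card_lists_length_le) (auto simp: card_UNIV_bool)
  also have "real \<dots> = 2 ^ Suc s - 1"
    using geometric_sum[of "2::real" "Suc s"] by (simp add: lessThan_Suc_atMost)
  finally have cardM: "real (card ?M) = 2 ^ Suc s - 1" .
  have "?good \<subseteq> (\<Union>w\<in>?M. ?F w)"
  proof
    fix A assume A: "A \<in> ?good"
    then have "length (memory alg \<omega> A (dim_row A)) \<le> s"
      using space C \<omega> by (auto simp: uses_space_def)
    then show "A \<in> (\<Union>w\<in>?M. ?F w)"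
      using A by (auto simp: result_def)
  qed
  then have "real (card ?good) \<le> real (card (\<Union>w\<in>?M. ?F w))"
    using finM assms(4) by (intro of_nat_mono card_mono) auto
  also have "\<dots> \<le> real (\<Sum>w\<in>?M. card (?F w))"
    by (intro of_nat_mono card_UN_le finM)
  also have "\<dots> = (\<Sum>w\<in>?M. real (card (?F w)))"
    by (rule of_nat_sum)
  also have "\<dots> \<le> (\<Sum>w\<in>?M. L)"
  proof (intro sum_mono)
    fix w
    show "real (card (?F w)) \<le> L"
    proof (cases "?F w = {}")
      case True
      then show ?thesis using assms(7) by (metis card.empty of_nat_0)
    next
      case False
      then show ?thesis by (intro fibre[of _ "answer alg \<omega> w"]) auto
    qed
  qed
  also have "\<dots> = L * (2 ^ Suc s - 1)"
    by (simp only: sum_constant cardM mult.commute)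
  finally show ?thesis
    using half by linarith
qed

text \<open>The zero input forces the answer to have zero covariance, which is at distance n from
  that of a single all-ones row, while only \<epsilon> n < n is allowed. The bound later absorbs
  additive constants into multiples of \<open>s\<close>.\<close>

lemma one_le_space:
  assumes "0 < \<epsilon>" "\<epsilon> < 1" "1 \<le> W" "1 \<le> n" and E: "{-1, 0, 1} \<subseteq> E"
    and alg: "approximates_covariance alg (input_matrices E W n) \<epsilon> (8/9)"
    and space: "uses_space alg (input_matrices E W n) s"
  shows "1 \<le> s"
proof (rule ccontr)
  let ?Z = "top_rows W n 0 (\<lambda>_ _. 1)"
  let ?A = "top_rows W n 1 (\<lambda>_ _. 1)"
  let ?G = "\<lambda>A. transpose_mat A * A :: real mat"
  have massZ: "(frob_norm ?Z)\<^sup>2 = 0" and massA: "(frob_norm ?A)\<^sup>2 = real n"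
    using assms by (auto simp: top_rows_mass)
  have neq: "?Z \<noteq> ?A"
    using massZ massA assms by auto
  have incompatible: False if "covariance_approx \<epsilon> ?Z B" "covariance_approx \<epsilon> ?A B" for B
  proof -
    have "dim_col B = n"
      using that by (simp add: covariance_approx_def top_rows_def)
    then have GB: "?G B \<in> carrier_mat n n"
      by (auto intro!: carrier_matI)
    have GA: "?G (top_rows W n k a) \<in> carrier_mat n n" for k a
      using top_rows_carrier by (metis mult_carrier_mat transpose_carrier_mat)
    have "frob_norm (?G ?Z - ?G B) \<le> 0"
      using that(1) unfolding covariance_approx_def massZ by simp
    then have "frob_norm (?G ?Z - ?G B) = 0"
      by (rule order_antisym) (rule frob_norm_nonneg)
    then have "(frob_norm (?G ?Z - ?G B))\<^sup>2 = 0"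
      by (simp only: power_zero_numeral)
    then have "(\<Sum>i<n. \<Sum>j<n. (?G B $$ (i, j))\<^sup>2) = 0"
      using assms by (simp add: frob_norm_diff_square[OF GA GB] top_rows_covariance)
    then have "?G B $$ (i, j) = 0" if "i < n" "j < n" for i j
      using that by (simp add: sum_nonneg_eq_0_iff sum_nonneg)
    then have "(frob_norm (?G ?A - ?G B))\<^sup>2 = (real n)\<^sup>2"
      using assms by (simp add: frob_norm_diff_square[OF GA GB] top_rows_covariance power2_eq_square[of "real n"])
    moreover have "frob_norm (?G ?A - ?G B) \<le> \<epsilon> * real n"
      using that(2) massA by (simp add: covariance_approx_def)
    moreover have "\<epsilon> * real n < real n"
      using assms by simp
    ultimately show False
      using frob_norm_nonneg[of "?G ?A - ?G B"] by (auto simp: power2_eq_iff)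
  qed
  assume "\<not> 1 \<le> s"
  then have "s = 0" by simp
  \<comment> \<open>With \<open>s = 0\<close> there is only the empty word, and the strict
    inequality reads 2 < 2.\<close>
  have "real (card {?Z, ?A}) < 2 * 1 * (2 ^ Suc s - 1)"
  proof (rule memory_lower_bound[OF alg space])
    show "{?Z, ?A} \<subseteq> input_matrices E W n"
      using E by (auto intro!: top_rows_input)
    fix S B assume S: "S \<subseteq> {?Z, ?A}" "S \<noteq> {}"
      and B: "\<And>A. A \<in> S \<Longrightarrow> covariance_approx \<epsilon> A B"
    then have "S = {?Z} \<or> S = {?A}"
      using incompatible[of B] by auto
    then show "real (card S) \<le> 1" by auto
  qed auto
  then show False
    using neq \<open>s = 0\<close> by simp
qed

text \<open>All matrices of the family have mass \<open>k * n\<close>. The last hypothesis makes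
  \<open>L\<close> an upper bound for the Plotkin quotient, hence for the number of inputs that one
  answer serves.\<close>

lemma sign_family_card_less:
  fixes a :: "'x \<Rightarrow> nat \<Rightarrow> nat \<Rightarrow> real"
  assumes alg: "approximates_covariance alg (input_matrices E W n) \<epsilon> (8/9)"
    and space: "uses_space alg (input_matrices E W n) s"
    and E: "{-1, 0, 1} \<subseteq> E" and "k \<le> W" and "0 \<le> \<epsilon>"
    and "finite C" "C \<noteq> {}"
    and signs: "\<And>x r j. x \<in> C \<Longrightarrow> r < k \<Longrightarrow> j < n \<Longrightarrow> a x r j \<in> {-1, 1}"
    and far: "\<And>x y. x \<in> C \<Longrightarrow> y \<in> C \<Longrightarrow> x \<noteq> y \<Longrightarrow> D \<le>
      (\<Sum>i<n. \<Sum>j<n. ((\<Sum>r<k. a x r i * a x r j) - (\<Sum>r<k. a y r i * a y r j))\<^sup>2)"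
    and "0 < D" "0 \<le> L" and L: "D \<le> L * (D - 2 * (\<epsilon> * (real k * real n))\<^sup>2)"
  shows "real (card C) < 2 * L * (2 ^ Suc s - 1)"
proof -
  let ?A = "\<lambda>x. top_rows W n k (a x)"
  have far': "D \<le> (frob_norm (transpose_mat (?A x) * ?A x - transpose_mat (?A y) * ?A y))\<^sup>2"
    if "x \<in> C" "y \<in> C" "x \<noteq> y" for x y
    using far[OF that] assms(4) by (simp add: top_rows_distance)
  \<comment> \<open>Since \<open>D\<close> is positive, distinct codewords give distinct matrices,
    so counting matrices counts codewords.\<close>
  have inj: "inj_on ?A C"
  proof (rule inj_onI, rule ccontr)
    fix x y assume xy: "x \<in> C" "y \<in> C" "?A x = ?A y" "x \<noteq> y"
    have "(frob_norm (transpose_mat (?A x) * ?A x - transpose_mat (?A x) * ?A x))\<^sup>2 = 0"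
      using assms(4) by (simp add: top_rows_distance)
    then show False
      using far'[of x y] xy assms(10) by simp
  qed
  have pos: "0 < D - 2 * (\<epsilon> * (real k * real n))\<^sup>2"
  proof (rule ccontr)
    assume "\<not> ?thesis"
    then have "L * (D - 2 * (\<epsilon> * (real k * real n))\<^sup>2) \<le> 0"
      using assms(11) by (intro mult_nonneg_nonpos) auto
    then show False
      using L assms(10) by linarith
  qed
  have "real (card (?A ` C)) < 2 * L * (2 ^ Suc s - 1)"
  proof (rule memory_lower_bound[OF alg space])
    show "?A ` C \<subseteq> input_matrices E W n"
      using E signs by (auto intro!: top_rows_input)
    fix S B assume S: "S \<subseteq> ?A ` C" "S \<noteq> {}"
      and B: "\<And>A. A \<in> S \<Longrightarrow> covariance_approx \<epsilon> A B"
    have "real (card S) * (D - 2 * (\<epsilon> * (real k * real n))\<^sup>2) \<le> D"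
    proof (rule covariance_approx_card_le[of S W n])
      show "finite S"
        using S(1) assms(6) finite_surj by blast
      show "S \<subseteq> carrier_mat W n"
        using S(1) by auto
      show "(frob_norm A)\<^sup>2 = real k * real n" if "A \<in> S" for A
        using that S(1) assms(4) signs by (auto intro!: top_rows_mass)
      show "D \<le> (frob_norm (transpose_mat A * A - transpose_mat A' * A'))\<^sup>2"
        if A: "A \<in> S" "A' \<in> S" "A \<noteq> A'" for A A'
      proof -
        obtain x y where "x \<in> C" "y \<in> C" "A = ?A x" "A' = ?A y"
          using S(1) A by blast
        then show ?thesis
          using far'[of x y] A(3) by blast
      qed
    qed (use S(2) B assms(5) in auto)
    then have "real (card S) * (D - 2 * (\<epsilon> * (real k * real n))\<^sup>2)
        \<le> L * (D - 2 * (\<epsilon> * (real k * real n))\<^sup>2)"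
      using L by linarith
    then show "real (card S) \<le> L"
      using pos by simp
  qed (use assms(6,7,11) in auto)
  then show ?thesis
    using inj by (simp add: card_image)
qed

section \<open>From code sizes to bits, in the two ranges of \<epsilon>\<close>

lemma exponent_less:
  fixes L :: real
  assumes "exp u \<le> 2 * N" and "N < 2 * L * (2 ^ Suc s - 1)" and "0 < L"
  shows "u < real s + 8 * L"
proof -
  \<comment> \<open>Crude estimates suffice because \<open>L\<close> will be a constant:
    \<open>8 * L\<close> is below its own exponential, and 2 is below e.\<close>
  have "exp u < 8 * L * 2 ^ s"
    using assms by (simp add: algebra_simps)
  also have "\<dots> \<le> exp (8 * L) * exp 1 ^ s"
    using assms(3) exp_ge_add_one_self[of "8 * L"] exp_ge_add_one_self[of 1]
    by (intro mult_mono power_mono) (linarith | simp)+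
  also have "\<dots> = exp (real s + 8 * L)"
    by (simp add: exp_add flip: exp_of_nat_mult)
  finally show ?thesis by simp
qed

text \<open>For single sign rows x and y the squared distance of the covariance matrices is 2 n^2 -
  2 <x, y>^2, so a nearly orthogonal code of size exponential in \<delta> n yields the
  bound.\<close>

lemma space_bound_coarse:
  assumes "0 < \<delta>" "0 < \<epsilon>" "\<epsilon> \<le> 1 - \<delta>" "1 \<le> W" "1 \<le> n" and E: "{-1, 0, 1} \<subseteq> E"
    and alg: "approximates_covariance alg (input_matrices E W n) \<epsilon> (8/9)"
    and space: "uses_space alg (input_matrices E W n) s"
  shows "\<delta> * real n / 8 < real s + 16 / \<delta>"
proof -
  let ?N = "real n"
  \<comment> \<open>This \<open>t\<close> makes the loss 2 (t n)^2 in the squared distance equal to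
    \<delta> n^2.\<close>
  define t where "t = sqrt (\<delta> / 2)"
  have t: "0 < t" "t < 1" and t2: "t\<^sup>2 = \<delta> / 2"
    using assms by (auto simp: t_def)
  obtain C where C: "C \<subseteq> {..<n} \<rightarrow>\<^sub>E {-1, 1::real}"
    and ip: "\<And>x y. x \<in> C \<Longrightarrow> y \<in> C \<Longrightarrow> x \<noteq> y \<Longrightarrow> \<bar>\<Sum>i<n. x i * y i\<bar> \<le> t * ?N"
    and cardC: "exp (\<delta> * ?N / 8) \<le> 2 * real (card C)"
    using exists_sign_code[of "{..<n}" t] t t2 assms(5) by (auto simp: lessThan_empty_iff)
  have sq: "(x i)\<^sup>2 = 1" if "x \<in> C" "i < n" for x i
  proof -
    have "x i \<in> {-1, 1}"
      using C that by (auto simp: subset_iff PiE_iff)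
    then show ?thesis by auto
  qed
  have "real (card C) < 2 * (2 / \<delta>) * (2 ^ Suc s - 1)"
  proof (rule sign_family_card_less[where a = "\<lambda>x r j. x j" and k = 1 and D = "?N\<^sup>2 * (2 - \<delta>)",
        OF alg space E])
    show "finite C"
      using C by (rule finite_subset) (auto intro: finite_PiE)
    show "C \<noteq> {}"
      using cardC by (metis card.empty exp_gt_zero mult_zero_right not_le of_nat_0)
    show "x j \<in> {-1, 1}" if "x \<in> C" "j < n" for x j
      using C that by (auto simp: subset_iff PiE_iff)
    show "?N\<^sup>2 * (2 - \<delta>)
        \<le> (\<Sum>i<n. \<Sum>j<n. ((\<Sum>r<1::nat. x i * x j) - (\<Sum>r<1::nat. y i * y j))\<^sup>2)"
      if xy: "x \<in> C" "y \<in> C" "x \<noteq> y" for x y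
    proof -
      have "(\<Sum>i<n. \<Sum>j<n. ((\<Sum>r<1::nat. x i * x j) - (\<Sum>r<1::nat. y i * y j))\<^sup>2)
          = (\<Sum>i<n. \<Sum>j<n. 2 - 2 * ((x i * y i) * (x j * y j)))"
      proof (intro sum.cong refl)
        fix i j assume ij: "i \<in> {..<n}" "j \<in> {..<n}"
        have "((\<Sum>r<1::nat. x i * x j) - (\<Sum>r<1::nat. y i * y j))\<^sup>2
            = (x i)\<^sup>2 * (x j)\<^sup>2 + (y i)\<^sup>2 * (y j)\<^sup>2 - 2 * ((x i * y i) * (x j * y j))"
          by (simp add: power2_eq_square algebra_simps)
        then show "((\<Sum>r<1::nat. x i * x j) - (\<Sum>r<1::nat. y i * y j))\<^sup>2
            = 2 - 2 * ((x i * y i) * (x j * y j))"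
          using ij sq xy by simp
      qed
      also have "\<dots> = 2 * ?N\<^sup>2 - 2 * (\<Sum>i<n. x i * y i)\<^sup>2"
        by (simp add: sum_subtractf power2_eq_square sum_product flip: sum_distrib_left)
      finally have eq: "(\<Sum>i<n. \<Sum>j<n. ((\<Sum>r<1::nat. x i * x j) - (\<Sum>r<1::nat. y i * y j))\<^sup>2)
          = 2 * ?N\<^sup>2 - 2 * (\<Sum>i<n. x i * y i)\<^sup>2" .
      have "(\<Sum>i<n. x i * y i)\<^sup>2 \<le> (t * ?N)\<^sup>2"
        using ip[OF xy] by (metis abs_ge_zero power2_abs power_mono)
      then show ?thesis
        unfolding eq by (simp add: power_mult_distrib t2 algebra_simps)
    qed
    show "0 < ?N\<^sup>2 * (2 - \<delta>)"
      using assms by simp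
    \<comment> \<open>The Plotkin gap \<open>D - 2 * r\<close> stays at least \<delta> n^2 by
      \<open>\<epsilon> \<le> 1 - \<delta>\<close>; as \<open>D\<close> is at most 2 n^2, one answer
      serves at most 2 / \<delta> inputs.\<close>
    have "\<epsilon>\<^sup>2 \<le> \<epsilon> * 1"
      unfolding power2_eq_square using assms by (intro mult_left_mono) auto
    then have "\<delta> \<le> 2 - \<delta> - 2 * \<epsilon>\<^sup>2"
      using assms by linarith
    then have "2 / \<delta> * (?N\<^sup>2 * \<delta>) \<le> 2 / \<delta> * (?N\<^sup>2 * (2 - \<delta> - 2 * \<epsilon>\<^sup>2))"
      using assms by (intro mult_left_mono) auto
    moreover have "?N\<^sup>2 * (2 - \<delta>) \<le> 2 / \<delta> * (?N\<^sup>2 * \<delta>)"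
      using assms by (simp add: algebra_simps)
    ultimately show "?N\<^sup>2 * (2 - \<delta>) \<le> 2 / \<delta> * (?N\<^sup>2 * (2 - \<delta>) - 2 * (\<epsilon> * (real 1 * ?N))\<^sup>2)"
      by (simp add: power_mult_distrib algebra_simps)
  qed (use assms in auto)
  from exponent_less[OF cardC this] show ?thesis
    using assms(1) by simp
qed

lemma exists_half_power:
  fixes n :: nat
  assumes "2 \<le> n"
  obtains b where "2 * 2 ^ b \<le> n" and "n < 4 * 2 ^ b"
proof -
  obtain e where e: "2 ^ e \<le> n" "n < 2 ^ (e + 1)"
    using ex_power_ivl1[of 2 n] assms by auto
  with assms have "e \<noteq> 0"
    by (cases e) auto
  then obtain b where "e = Suc b"
    using not0_implies_Suc by blast
  with e show thesis
    using that[of b] by simp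
qed

text \<open>
  The first \<open>P\<close> columns are rows of a Hadamard matrix, hence the off-diagonal block of \<open>A\<^sup>T A\<close> is
  an isometric image (up to the factor \<open>P\<close>) of the free block of \<open>A\<close>, which ranges over a code.
\<close>

lemma space_bound_fine:
  assumes "0 < \<epsilon>" and k: "1 \<le> k" "k \<le> W" "4 * k \<le> n" "32 * \<epsilon>\<^sup>2 * real k \<le> 1"
    and E: "{-1, 0, 1} \<subseteq> E"
    and alg: "approximates_covariance alg (input_matrices E W n) \<epsilon> (8/9)"
    and space: "uses_space alg (input_matrices E W n) s"
  shows "real k * real n / 32 < real s + 16"
proof -
  \<comment> \<open>The power of two lies between n/4 and n/2: it exceeds \<open>k\<close>, so
    enough Hadamard rows exist, and at least half of the columns remain free.\<close>
  obtain b where b: "2 * 2 ^ b \<le> n" "n < 4 * 2 ^ b"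
    using exists_half_power[of n] k by auto
  define P :: nat where "P = 2 ^ b"
  define q where "q = n - P"
  have P: "2 * P \<le> n" "n < 4 * P" "k \<le> P" and n: "n = P + q" and q: "n \<le> 2 * q"
    using b k unfolding P_def q_def by auto
  obtain h :: "nat \<Rightarrow> nat \<Rightarrow> real" where h: "\<And>r i. h r i \<in> {-1, 1}"
    and "\<And>r r'. r < P \<Longrightarrow> r' < P \<Longrightarrow> (\<Sum>i<P. h r i * h r' i) = (if r = r' then 2 ^ b else 0)"
    using exists_hadamard[of b] unfolding P_def by blast
  then have orth: "\<And>r r'. r < k \<Longrightarrow> r' < k \<Longrightarrow> (\<Sum>i<P. h r i * h r' i) = (if r = r' then real P else 0)"
    using P(3) by (simp add: P_def)
  let ?I = "{..<k} \<times> {..<q}"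
  let ?m = "real k * real q"
  have cardI: "real (card ?I) = ?m"
    by simp
  have m: "real k * real n / 2 \<le> ?m"
    using mult_left_mono[of "real n" "2 * real q" "real k"] q by simp
  \<comment> \<open>Correlation at most half the length keeps codewords at squared distance at least
    \<open>?m\<close>.\<close>
  obtain C where C: "C \<subseteq> ?I \<rightarrow>\<^sub>E {-1, 1::real}"
    and ip: "\<And>x y. x \<in> C \<Longrightarrow> y \<in> C \<Longrightarrow> x \<noteq> y \<Longrightarrow> \<bar>\<Sum>p\<in>?I. x p * y p\<bar> \<le> 1/2 * ?m"
    and cardC: "exp (?m / 16) \<le> 2 * real (card C)"
    using exists_sign_code[of ?I "1/2"] k q unfolding cardI
    by (auto simp: lessThan_empty_iff power2_eq_square)
  have signs: "x p \<in> {-1, 1}" if "x \<in> C" "p \<in> ?I" for x p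
    using C that by (meson PiE_mem subsetD)
  define a where "a x r j = (if j < P then h r j else x (r, j - P))" for x :: "nat \<times> nat \<Rightarrow> real" and r j
  let ?g = "\<lambda>x i j. \<Sum>r<k. a x r i * a x r j"
  have "real (card C) < 2 * 2 * (2 ^ Suc s - 1)"
  \<comment> \<open>The value of \<open>D\<close> is n/4 times k n/2, lower bounds for
    \<open>P\<close> and for the squared code distance.\<close>
  proof (rule sign_family_card_less[where a = a and k = k and D = "real k * (real n)\<^sup>2 / 8",
        OF alg space E])
    show "finite C"
      using C by (rule finite_subset) (auto intro: finite_PiE)
    show "C \<noteq> {}"
      using cardC by (metis card.empty exp_gt_zero mult_zero_right not_le of_nat_0)
    show "a x r j \<in> {-1, 1}" if "x \<in> C" "r < k" "j < n" for x r j
      using h[of r j] signs[OF that(1), of "(r, j - P)"] that n by (auto simp: a_def)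
    show "real k * (real n)\<^sup>2 / 8 \<le> (\<Sum>i<n. \<Sum>j<n. (?g x i j - ?g y i j)\<^sup>2)"
      if xy: "x \<in> C" "y \<in> C" "x \<noteq> y" for x y
    proof -
      have "(\<Sum>p\<in>?I. (x p - y p)\<^sup>2) = (\<Sum>p\<in>?I. 2 - 2 * (x p * y p))"
      proof (intro sum.cong refl)
        fix p assume "p \<in> ?I"
        then show "(x p - y p)\<^sup>2 = 2 - 2 * (x p * y p)"
          using signs[OF xy(1)] signs[OF xy(2)] by fastforce
      qed
      also have "\<dots> = 2 * ?m - 2 * (\<Sum>p\<in>?I. x p * y p)"
        by (simp add: sum_subtractf flip: sum_distrib_left)
      finally have block: "?m \<le> (\<Sum>p\<in>?I. (x p - y p)\<^sup>2)"
        using ip[OF xy] by linarith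
      have "real k * (real n)\<^sup>2 / 8 = (real n / 4) * (real k * real n / 2)"
        by (simp add: power2_eq_square)
      also have "\<dots> \<le> real P * ?m"
        using P(2) m by (intro mult_mono) auto
      also have "\<dots> \<le> real P * (\<Sum>p\<in>?I. (x p - y p)\<^sup>2)"
        using block by (intro mult_left_mono) auto
      also have "\<dots> = (\<Sum>l<q. real P * (\<Sum>r<k. (x (r, l) - y (r, l))\<^sup>2))"
      proof -
        have "(\<Sum>p\<in>?I. (x p - y p)\<^sup>2) = (\<Sum>l<q. \<Sum>r<k. (x (r, l) - y (r, l))\<^sup>2)"
          by (subst sum.swap) (simp add: sum.cartesian_product case_prod_unfold)
        then show ?thesis
          by (simp add: sum_distrib_left)
      qed
      also have "\<dots> = (\<Sum>l<q. \<Sum>i<P. (\<Sum>r<k. h r i * (x (r, l) - y (r, l)))\<^sup>2)"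
        by (simp add: orthogonal_rows_energy[OF orth])
      also have "\<dots> = (\<Sum>i<P. \<Sum>l<q. (\<Sum>r<k. h r i * (x (r, l) - y (r, l)))\<^sup>2)"
        by (rule sum.swap)
      also have "\<dots> = (\<Sum>i<P. \<Sum>l<q. (?g x i (l + P) - ?g y i (l + P))\<^sup>2)"
        by (intro sum.cong refl) (simp add: a_def right_diff_distrib sum_subtractf)
      also have "\<dots> = (\<Sum>i<P. \<Sum>j=P..<n. (?g x i j - ?g y i j)\<^sup>2)"
        unfolding n using sum.shift_bounds_nat_ivl[of "\<lambda>j. (?g x i j - ?g y i j)\<^sup>2" 0 P q for i]
        by (simp add: atLeast0LessThan add.commute)
      \<comment> \<open>Only the block pairing Hadamard columns with code columns has been counted;
        the other entries contribute nonnegative terms.\<close>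
      also have "\<dots> \<le> (\<Sum>i<P. \<Sum>j<n. (?g x i j - ?g y i j)\<^sup>2)"
        by (intro sum_mono sum_mono2) auto
      also have "\<dots> \<le> (\<Sum>i<n. \<Sum>j<n. (?g x i j - ?g y i j)\<^sup>2)"
        using n by (intro sum_mono2 sum_nonneg) auto
      finally show ?thesis .
    qed
    show "0 < real k * (real n)\<^sup>2 / 8"
      using k by simp
    \<comment> \<open>The bound on \<epsilon>^2 k makes the squared radius at most
      \<open>D / 4\<close>, so that one answer serves at most 2 inputs.\<close>
    have "4 * (\<epsilon> * (real k * real n))\<^sup>2 = (32 * \<epsilon>\<^sup>2 * real k) * (real k * (real n)\<^sup>2 / 8)"
      by (simp add: power2_eq_square)
    also have "\<dots> \<le> 1 * (real k * (real n)\<^sup>2 / 8)"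
      using k by (intro mult_right_mono) auto
    finally show "real k * (real n)\<^sup>2 / 8 \<le> 2 * (real k * (real n)\<^sup>2 / 8 - 2 * (\<epsilon> * (real k * real n))\<^sup>2)"
      by simp
  qed (use assms in auto)
  from exponent_less[OF cardC this] show ?thesis
    using m by simp
qed

section \<open>Constants and combination of the two ranges of \<epsilon>\<close>

theorem mainTheorem11:
  fixes K \<delta> :: real
  assumes "K > 0" and "\<delta> > 0"
  shows "\<exists>c>0. \<forall>(W::nat) (n::nat) (\<epsilon>::real) (E::real set) (alg::stream_alg) (s::nat).
    0 < \<epsilon> \<longrightarrow> \<epsilon> \<le> 1 - \<delta> \<longrightarrow>
    1 / \<epsilon>\<^sup>2 \<le> K * real n \<longrightarrow> 1 / \<epsilon>\<^sup>2 \<le> K * real W \<longrightarrow>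
    {-1, 0, 1} \<subseteq> E \<longrightarrow>
    approximates_covariance alg (input_matrices E W n) \<epsilon> (8/9) \<longrightarrow>
    uses_space alg (input_matrices E W n) s \<longrightarrow>
    c * (real n / \<epsilon>\<^sup>2) \<le> real s"
proof -
  \<comment> \<open>For \<open>k\<close> at most c0 / \<epsilon>^2, the term 1/32 secures
    \<open>32 * \<epsilon>\<^sup>2 * k \<le> 1\<close>, and 1 / (4 K) secures
    \<open>4 * k \<le> n\<close> and \<open>k \<le> W\<close>.\<close>
  define c0 where "c0 = min (1/32) (1 / (4 * K))"
  have c0: "0 < c0" "c0 \<le> 1/32" "c0 * K \<le> 1/4"
  proof -
    show "0 < c0" "c0 \<le> 1/32"
      using assms by (auto simp: c0_def)
    have "c0 * K \<le> 1 / (4 * K) * K"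
      using assms by (intro mult_right_mono) (auto simp: c0_def)
    then show "c0 * K \<le> 1/4"
      using assms by simp
  qed
  \<comment> \<open>Here 1088 = 2 * 32 * 17: the factor 2 from rounding down to \<open>k\<close>, 32
    from \<open>space_bound_fine\<close>, and 17 from \<open>s + 16 \<le> 17 * s\<close>.\<close>
  define c1 where "c1 = c0 / 1088"
  \<comment> \<open>By \<open>1 \<le> s\<close>, the coarse bound has
    \<open>s + 16 / \<delta> \<le> M * s\<close>.\<close>
  define M where "M = 1 + 16 / \<delta>"
  have M: "0 < M"
    using assms(2) by (simp add: M_def add_pos_pos)
  define c2 where "c2 = \<delta> * c0 / (8 * M)"
  show ?thesis
  proof (intro exI[of _ "min c1 c2"] conjI allI impI)
    show "0 < min c1 c2"
      using c0 assms M by (simp add: c1_def c2_def)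
    fix W n s :: nat and \<epsilon> :: real and E alg
    assume \<epsilon>: "0 < \<epsilon>" "\<epsilon> \<le> 1 - \<delta>"
      and Kn: "1 / \<epsilon>\<^sup>2 \<le> K * real n" and KW: "1 / \<epsilon>\<^sup>2 \<le> K * real W"
      and E: "{-1, 0, 1} \<subseteq> E"
      and alg: "approximates_covariance alg (input_matrices E W n) \<epsilon> (8/9)"
      and space: "uses_space alg (input_matrices E W n) s"
    have inv_pos: "0 < 1 / \<epsilon>\<^sup>2"
      using \<epsilon> by simp
    then have W: "1 \<le> W" and n: "1 \<le> n"
      using Kn KW by (cases W; cases n; simp)+
    have s: "1 \<le> real s"
      using one_le_space[of \<epsilon> W n E alg s] \<epsilon> assms W n E alg space by simp
    have scale: "c0 / \<epsilon>\<^sup>2 \<le> real N / 4" if "1 / \<epsilon>\<^sup>2 \<le> K * real N" for N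
    proof -
      have "c0 * (1 / \<epsilon>\<^sup>2) \<le> c0 * (K * real N)"
        using that c0 by (intro mult_left_mono) auto
      also have "\<dots> = c0 * K * real N"
        by simp
      also have "\<dots> \<le> 1/4 * real N"
        using c0 by (intro mult_right_mono) auto
      finally show ?thesis by simp
    qed
    show "min c1 c2 * (real n / \<epsilon>\<^sup>2) \<le> real s"
    \<comment> \<open>The split decides whether the floor of c0 / \<epsilon>^2 supplies at least one
      row. If not, 1 / \<epsilon>^2 is below 1 / c0, and a bound linear in \<open>n\<close>
      suffices.\<close>
    proof (cases "1 \<le> c0 / \<epsilon>\<^sup>2")
      case True
      define k where "k = nat \<lfloor>c0 / \<epsilon>\<^sup>2\<rfloor>"
      have k: "1 \<le> k" "real k \<le> c0 / \<epsilon>\<^sup>2" "c0 / \<epsilon>\<^sup>2 < 2 * real k"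
      proof -
        have "1 \<le> \<lfloor>c0 / \<epsilon>\<^sup>2\<rfloor>"
          using True by simp
        then show "1 \<le> k" "real k \<le> c0 / \<epsilon>\<^sup>2" "c0 / \<epsilon>\<^sup>2 < 2 * real k"
          unfolding k_def by linarith+
      qed
      have "k \<le> W" "4 * k \<le> n"
        using k(2) scale[OF Kn] scale[OF KW] by linarith+
      moreover have "32 * \<epsilon>\<^sup>2 * real k \<le> 1"
      proof -
        have "32 * \<epsilon>\<^sup>2 * real k \<le> 32 * \<epsilon>\<^sup>2 * (c0 / \<epsilon>\<^sup>2)"
          using k(2) by (intro mult_left_mono) auto
        then show ?thesis
          using c0 \<epsilon> by simp
      qed
      ultimately have "real k * real n / 32 < real s + 16"
        using \<epsilon>(1) k(1) E alg space by (intro space_bound_fine)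
      then have "real k * real n \<le> 544 * real s"
        using s by linarith
      moreover have "(c0 / \<epsilon>\<^sup>2) * real n \<le> (2 * real k) * real n"
        using k(3) by (intro mult_right_mono) auto
      ultimately have "c1 * (real n / \<epsilon>\<^sup>2) \<le> real s"
        by (simp add: c1_def)
      moreover have "min c1 c2 * (real n / \<epsilon>\<^sup>2) \<le> c1 * (real n / \<epsilon>\<^sup>2)"
        by (intro mult_right_mono) auto
      ultimately show ?thesis
        by (rule order_trans[rotated])
    next
      case False
      have "\<delta> * real n / 8 < real s + 16 / \<delta>"
        using assms(2) \<epsilon> W n E alg space by (rule space_bound_coarse)
      also have "\<dots> \<le> real s * M"
        using mult_left_mono[OF s, of "16 / \<delta>"] assms(2) by (simp add: M_def algebra_simps)
      finally have main: "\<delta> * real n / 8 \<le> real s * M"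
        by simp
      have "(\<delta> * real n / 8) * (c0 / \<epsilon>\<^sup>2) \<le> (\<delta> * real n / 8) * 1"
        using False assms(2) by (intro mult_left_mono) auto
      then have "(\<delta> * real n / 8) * (c0 / \<epsilon>\<^sup>2) \<le> real s * M"
        using main by linarith
      moreover have "c2 * (real n / \<epsilon>\<^sup>2) = (\<delta> * real n / 8) * (c0 / \<epsilon>\<^sup>2) / M"
        by (simp add: c2_def mult_ac)
      ultimately have "c2 * (real n / \<epsilon>\<^sup>2) \<le> real s"
        by (simp only: pos_divide_le_eq[OF M])
      moreover have "min c1 c2 * (real n / \<epsilon>\<^sup>2) \<le> c2 * (real n / \<epsilon>\<^sup>2)"
        by (intro mult_right_mono) auto
      ultimately show ?thesis
        by (rule order_trans[rotated])
    qed
  qed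
qed

end
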